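(* Let $k,\ell \ge 2$ be integers. Let $A$ and $B$ be finite sets, each of size at least two, and let $\mathcal{R}$ be a family of sub-boxes that partitions the two-dimensional discrete box $A \times B$ and has the $(k,\ell)$-piercing property. Then $$|\mathcal{R}| \ \ge\ (k-1)+(\ell-1)+\left\lceil 2\sqrt{(k-1)(\ell-1)} \right\rceil .$$ Moreover, for every pair of integers $k,\ell \ge 2$ there exist finite sets $A,B$ (each of size at least two) and a family of exactly $(k-1)+(\ell-1)+2\left\lceil \sqrt{(k-1)(\ell-1)} \right\rceil$ sub-boxes that partitions $A\times B$ and has the $(k,\ell)$-piercing property.
   Context: A two-dimensional discrete box is a set of the form $A \times B$ where $A$ and $B$ are finite sets of size at least two. A sub-box of $A\times B$ is a set of the form $A'\times B'$ with $A'\subseteq A$ and $B'\subseteq B$. A family of sub-boxes partitions $A\times B$ if every element of $A\times B$ is contained in exactly one sub-box of the family. A row of $A\times B$ is a set $\{a\}\times B$ with $a\in A$, and a column is a set $A\times\{b\}$ with $b\in B$. A family of sub-boxes partitioning $A\times B$ has the $(k,\ell)$-piercing property if every row intersects at least $k$ sub-boxes of the family and every column intersects at least $\ell$ sub-boxes of the family. *)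

theory Defs
  imports Complex_Main
begin

definition box_sides :: "'a set \<Rightarrow> 'b set \<Rightarrow> bool" where
  "box_sides A B \<longleftrightarrow> finite A \<and> finite B \<and> card A \<ge> 2 \<and> card B \<ge> 2"

definition sub_box :: "'a set \<Rightarrow> 'b set \<Rightarrow> ('a \<times> 'b) set \<Rightarrow> bool" where
  "sub_box A B S \<longleftrightarrow> (\<exists>A' B'. A' \<subseteq> A \<and> B' \<subseteq> B \<and> S = A' \<times> B')"

definition partitions_box :: "'a set \<Rightarrow> 'b set \<Rightarrow> ('a \<times> 'b) set set \<Rightarrow> bool" where
  "partitions_box A B R \<longleftrightarrow>
     (\<forall>S\<in>R. sub_box A B S) \<and> (\<forall>x \<in> A \<times> B. \<exists>!S. S \<in> R \<and> x \<in> S)"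

definition row :: "'b set \<Rightarrow> 'a \<Rightarrow> ('a \<times> 'b) set" where
  "row B a = {a} \<times> B"

definition column :: "'a set \<Rightarrow> 'b \<Rightarrow> ('a \<times> 'b) set" where
  "column A b = A \<times> {b}"

definition piercing_property ::
    "nat \<Rightarrow> nat \<Rightarrow> 'a set \<Rightarrow> 'b set \<Rightarrow> ('a \<times> 'b) set set \<Rightarrow> bool" where
  "piercing_property k l A B R \<longleftrightarrow>
     (\<forall>a\<in>A. k \<le> card {S \<in> R. row B a \<inter> S \<noteq> {}}) \<and>
     (\<forall>b\<in>B. l \<le> card {S \<in> R. column A b \<inter> S \<noteq> {}})"

end

theory Submission
  imports Defs
begin

text \<open>
  Lower bound. A partition with sides \<open>M = |A|\<close>, \<open>N = |B|\<close> into \<open>n\<close> boxes of size \<open>p \<times> q\<close> satisfies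
  \<open>M N + n \<ge> M k + N l\<close>, by summing \<open>(p - 1) (q - 1) \<ge> 0\<close>. A column is deleted whenever each box
  confined to it is a single cell, and likewise for rows. The cell lost by a row is recorded as a
  deficit of that row, and boxes plus deficits (the cost) never increase. When no further deletion
  is possible, every column contains a box of width one with at least two cells and every row a box
  of height one with at least two cells, so \<open>n \<ge> M + N\<close>. With \<open>x = M - (l - 1)\<close>, \<open>y = N - (k - 1)\<close>
  and \<open>e = n - M - N \<ge> 0\<close> the first inequality reads \<open>x y + e \<ge> (k - 1) (l - 1)\<close>, whence
  \<open>(x + y + e)\<^sup>2 \<ge> 4 (k - 1) (l - 1)\<close>. The process also stops when \<open>M = l\<close> or \<open>N = k\<close>; then the
  first inequality alone gives cost at least \<open>k l\<close>.

  Construction. In a zero-one matrix take as boxes the ones of each column and the zeros of each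
  row. With \<open>c = \<lceil>sqrt ((k - 1) (l - 1))\<rceil>\<close>, a matrix with \<open>l - 1 + c\<close> rows and \<open>k - 1 + c\<close> columns
  can have \<open>k - 1\<close> ones in each row and at least \<open>l - 1\<close> zeros in each column.
\<close>

section \<open>Rectangular labellings and the count of cells\<close>

text \<open>The fibres of such a labelling are boxes; labels play the role of the sub-boxes.\<close>

definition rect_labelling :: "'a set \<Rightarrow> 'b set \<Rightarrow> ('a \<Rightarrow> 'b \<Rightarrow> 'c) \<Rightarrow> bool" where
  "rect_labelling A B f \<longleftrightarrow>
     (\<forall>a\<in>A. \<forall>a'\<in>A. \<forall>b\<in>B. \<forall>b'\<in>B. f a b = f a' b' \<longrightarrow> f a b' = f a b)"

definition labels :: "'a set \<Rightarrow> 'b set \<Rightarrow> ('a \<Rightarrow> 'b \<Rightarrow> 'c) \<Rightarrow> 'c set" where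
  "labels A B f = (\<Union>a\<in>A. f a ` B)"

lemma rect_labellingD:
  "rect_labelling A B f \<Longrightarrow> f a b = f a' b' \<Longrightarrow> a \<in> A \<Longrightarrow> a' \<in> A \<Longrightarrow> b \<in> B \<Longrightarrow> b' \<in> B
    \<Longrightarrow> f a b' = f a b"
  unfolding rect_labelling_def by blast

lemma rect_labelling_subset:
  "rect_labelling A B f \<Longrightarrow> A' \<subseteq> A \<Longrightarrow> B' \<subseteq> B \<Longrightarrow> rect_labelling A' B' f"
  unfolding rect_labelling_def by blast

lemma rect_labelling_swap:
  assumes "rect_labelling A B f"
  shows "rect_labelling B A (\<lambda>b a. f a b)"
  unfolding rect_labelling_def using rect_labellingD[OF assms] by metis

lemma labels_swap: "labels B A (\<lambda>b a. f a b) = labels A B f"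
  unfolding labels_def by blast

lemma finite_labels: "finite A \<Longrightarrow> finite B \<Longrightarrow> finite (labels A B f)"
  unfolding labels_def by blast

text \<open>Both sides count the pairs of a row and a label occurring in that row.\<close>

lemma sum_card_label_rows:
  assumes "finite A" "finite B"
  shows "(\<Sum>s\<in>labels A B f. card {a\<in>A. s \<in> f a ` B}) = (\<Sum>a\<in>A. card (f a ` B))"
proof -
  have "(\<Sum>s\<in>labels A B f. card {a\<in>A. s \<in> f a ` B})
      = (\<Sum>s\<in>labels A B f. \<Sum>a\<in>A. if s \<in> f a ` B then 1 else 0)"
    using assms by (simp add: sum.If_cases Int_def)
  also have "\<dots> = (\<Sum>a\<in>A. \<Sum>s\<in>labels A B f. if s \<in> f a ` B then 1 else 0)"
    by (rule sum.swap)
  also have "\<dots> = (\<Sum>a\<in>A. card (f a ` B))"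
  proof (rule sum.cong)
    fix a assume "a \<in> A"
    then have "labels A B f \<inter> {s. s \<in> f a ` B} = f a ` B"
      unfolding labels_def by blast
    then show "(\<Sum>s\<in>labels A B f. if s \<in> f a ` B then 1 else 0) = card (f a ` B)"
      by (simp add: sum.If_cases finite_labels assms)
  qed simp
  finally show ?thesis .
qed

text \<open>A label seen in \<open>p\<close> rows and \<open>q\<close> columns fills exactly
  \<open>p * q\<close> cells, by the rectangle condition, and \<open>p + q \<le> p * q + 1\<close>
  as both are positive. Over all labels the products add up to the number of cells.\<close>

lemma card_rect_le:
  assumes fin: "finite A" "finite B" and rect: "rect_labelling A B f"
  shows "(\<Sum>a\<in>A. card (f a ` B)) + (\<Sum>b\<in>B. card ((\<lambda>a. f a b) ` A))
           \<le> card A * card B + card (labels A B f)"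
proof -
  let ?L = "labels A B f"
  define P where "P s = {a\<in>A. s \<in> f a ` B}" for s
  define Q where "Q s = {b\<in>B. s \<in> (\<lambda>a. f a b) ` A}" for s
  have P: "(\<Sum>s\<in>?L. card (P s)) = (\<Sum>a\<in>A. card (f a ` B))"
    unfolding P_def by (rule sum_card_label_rows[OF fin])
  have Q: "(\<Sum>s\<in>?L. card (Q s)) = (\<Sum>b\<in>B. card ((\<lambda>a. f a b) ` A))"
    unfolding Q_def using sum_card_label_rows[OF fin(2,1), of "\<lambda>b a. f a b"]
    by (simp add: labels_swap[of B A f])
  have finPQ: "finite (P s)" "finite (Q s)" for s
    using fin by (auto simp: P_def Q_def)
  have fibre: "P s \<times> Q s = {x\<in>A\<times>B. case_prod f x = s}" for s
  proof -
    have 1: "f a b = s" if "a \<in> P s" "b \<in> Q s" for a b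
    proof -
      from that(1) obtain b' where "a \<in> A" "b' \<in> B" "f a b' = s"
        unfolding P_def by auto
      moreover from that(2) obtain a' where "b \<in> B" "a' \<in> A" "f a' b = s"
        unfolding Q_def by auto
      ultimately show ?thesis using rect_labellingD[OF rect, of a b' a' b] by simp
    qed
    have 2: "a \<in> P (f a b)" "b \<in> Q (f a b)" if "a \<in> A" "b \<in> B" for a b
      using that unfolding P_def Q_def by auto
    have 3: "P s \<subseteq> A" "Q s \<subseteq> B"
      unfolding P_def Q_def by auto
    show ?thesis
    proof (intro equalityI subsetI)
      fix x assume "x \<in> P s \<times> Q s"
      then show "x \<in> {x\<in>A\<times>B. case_prod f x = s}"
        using 1[of "fst x" "snd x"] 3 by (simp add: mem_Times_iff split_beta subset_iff)
    next
      fix x assume "x \<in> {x\<in>A\<times>B. case_prod f x = s}"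
      then show "x \<in> P s \<times> Q s"
        using 2[of "fst x" "snd x"] by (simp add: mem_Times_iff split_beta)
    qed
  qed
  have "card A * card B = card (\<Union>s\<in>?L. P s \<times> Q s)"
  proof -
    have "(\<Union>s\<in>?L. P s \<times> Q s) = A \<times> B"
      unfolding fibre labels_def by auto
    then show ?thesis by (simp add: card_cartesian_product)
  qed
  also have "\<dots> = (\<Sum>s\<in>?L. card (P s \<times> Q s))"
    proof (intro card_UN_disjoint ballI impI)
    show "finite ?L" using fin by (rule finite_labels)
    show "finite (P s \<times> Q s)" for s using finPQ by blast
    show "P s \<times> Q s \<inter> P t \<times> Q t = {}" if "s \<noteq> t" for s t
      unfolding fibre using that by blast
  qed
  finally have PQ: "card A * card B = (\<Sum>s\<in>?L. card (P s) * card (Q s))"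
    by (simp add: card_cartesian_product)
  have "(\<Sum>s\<in>?L. card (P s) + card (Q s)) \<le> (\<Sum>s\<in>?L. card (P s) * card (Q s) + 1)"
  proof (rule sum_mono)
    fix s assume "s \<in> ?L"
    then have "P s \<noteq> {}" "Q s \<noteq> {}"
      unfolding P_def Q_def labels_def by blast+
    then have "card (P s) > 0" "card (Q s) > 0" using finPQ by (auto simp: card_gt_0_iff)
    then obtain p q where "card (P s) = Suc p" "card (Q s) = Suc q"
      using gr0_implies_Suc by meson
    then show "card (P s) + card (Q s) \<le> card (P s) * card (Q s) + 1" by simp
  qed
  then show ?thesis unfolding sum.distrib P Q PQ by simp
qed

section \<open>Deleting a column, and grids where nothing can be deleted\<close>

text \<open>A label confined to column \<open>b\<close> but occurring in one row only is traded for a unit of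
  deficit in that row, so deleting the column does not raise the total.\<close>

lemma delete_column:
  fixes g :: "'a \<Rightarrow> nat" and h :: "'b \<Rightarrow> nat"
  assumes fin: "finite A" "finite B" and rect: "rect_labelling A B f" and b: "b \<in> B"
    and inj: "inj_on (\<lambda>a. f a b) {a\<in>A. f a b \<notin> f a ` (B - {b})}"
  defines "g' \<equiv> \<lambda>a. g a + (if f a b \<notin> f a ` (B - {b}) then 1 else 0)"
  shows "card (labels A (B - {b}) f) + sum g' A + sum h (B - {b})
           \<le> card (labels A B f) + sum g A + sum h B"
    and "card (f a ` B) + g a \<le> card (f a ` (B - {b})) + g' a"
proof -
  define A0 where "A0 = {a\<in>A. f a b \<notin> f a ` (B - {b})}"
  let ?F = "(\<lambda>a. f a b) ` A0"
  \<comment> \<open>By the rectangle condition, a label missing from the rest of its own row is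
    missing from the whole grid outside column \<open>b\<close>, so it vanishes with the
    column.\<close>
  have "f a b \<noteq> f a' b'" if "a \<in> A0" "a' \<in> A" "b' \<in> B - {b}" for a a' b'
    using rect_labellingD[OF rect, of a b a' b'] that b unfolding A0_def by force
  then have disj: "labels A (B - {b}) f \<inter> ?F = {}"
    unfolding labels_def by fastforce
  have sub: "labels A (B - {b}) f \<union> ?F \<subseteq> labels A B f"
    unfolding labels_def A0_def using b by blast
  \<comment> \<open>Injectivity makes the number of vanishing labels equal to the number of rows
    whose deficit grows.\<close>
  have "card (labels A (B - {b}) f) + card A0 = card (labels A (B - {b}) f) + card ?F"
    using inj by (simp add: card_image A0_def)
  also have "\<dots> = card (labels A (B - {b}) f \<union> ?F)"
    using disj fin by (intro card_Un_disjoint[symmetric]) (auto simp: finite_labels A0_def)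
  also have "\<dots> \<le> card (labels A B f)"
    using sub fin by (intro card_mono) (auto simp: finite_labels)
  finally have 1: "card (labels A (B - {b}) f) + card A0 \<le> card (labels A B f)" .
  have 2: "sum g' A = sum g A + card A0"
    unfolding g'_def A0_def using fin by (simp add: sum.distrib sum.If_cases Int_def)
  have 3: "sum h (B - {b}) \<le> sum h B"
    using fin by (intro sum_mono2) auto
  show "card (labels A (B - {b}) f) + sum g' A + sum h (B - {b})
           \<le> card (labels A B f) + sum g A + sum h B"
    using 1 2 3 by linarith
  have "f a ` B = insert (f a b) (f a ` (B - {b}))" using b by blast
  then show "card (f a ` B) + g a \<le> card (f a ` (B - {b})) + g' a"
    unfolding g'_def using fin by (simp add: card_insert_if)
qed

text \<open>Failure of injectivity gives each column \<open>b\<close> a label \<open>?v b\<close>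
  confined to it, and each row \<open>a\<close> a label \<open>?h a\<close> confined to it and
  repeated in it. Confinement makes both maps injective; the repetition of \<open>?h a\<close> keeps
  their images apart.\<close>

lemma card_labels_ge:
  assumes fin: "finite A" "finite B" and rect: "rect_labelling A B f"
    and col: "\<And>b. b \<in> B \<Longrightarrow> \<not> inj_on (\<lambda>a. f a b) {a\<in>A. f a b \<notin> f a ` (B - {b})}"
    and row: "\<And>a. a \<in> A \<Longrightarrow> \<not> inj_on (f a) {b\<in>B. f a b \<notin> (\<lambda>a. f a b) ` (A - {a})}"
  shows "card A + card B \<le> card (labels A B f)"
proof -
  have "\<forall>b\<in>B. \<exists>a a'. a \<in> A \<and> a' \<in> A \<and> a \<noteq> a' \<and> f a b = f a' b \<and> f a b \<notin> f a ` (B - {b})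
      \<and> f a' b \<notin> f a' ` (B - {b})"
    using col unfolding inj_on_def by blast
  then obtain u u' where u: "\<And>b. b \<in> B \<Longrightarrow> u b \<in> A \<and> u' b \<in> A \<and> u b \<noteq> u' b \<and>
      f (u b) b = f (u' b) b \<and> f (u b) b \<notin> f (u b) ` (B - {b})"
    by metis
  have "\<forall>a\<in>A. \<exists>b b'. b \<in> B \<and> b' \<in> B \<and> b \<noteq> b' \<and> f a b = f a b'
      \<and> f a b \<notin> (\<lambda>a. f a b) ` (A - {a})"
    using row unfolding inj_on_def by blast
  then obtain w w' where w: "\<And>a. a \<in> A \<Longrightarrow> w a \<in> B \<and> w' a \<in> B \<and> w a \<noteq> w' a \<and>
      f a (w a) = f a (w' a) \<and> f a (w a) \<notin> (\<lambda>a'. f a' (w a)) ` (A - {a})"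
    by metis
  let ?v = "\<lambda>b. f (u b) b" and ?h = "\<lambda>a. f a (w a)"
  have only_b: "b' = b" if "b \<in> B" "b' \<in> B" "a \<in> A" "?v b = f a b'" for a b b'
  proof (rule ccontr)
    assume "b' \<noteq> b"
    moreover have "f (u b) b' = ?v b"
      using rect_labellingD[OF rect that(4)] that u by blast
    ultimately show False using u[OF that(1)] that(2) by (metis Diff_iff imageI singletonD)
  qed
  have only_a: "a' = a" if "a \<in> A" "a' \<in> A" "b \<in> B" "?h a = f a' b" for a a' b
  proof (rule ccontr)
    assume "a' \<noteq> a"
    moreover have "f a' (w a) = ?h a"
      using rect_labellingD[OF rect that(4)[symmetric]] that w by metis
    ultimately show False using w[OF that(1)] that(2)
      by (metis (no_types, lifting) Diff_iff imageI singletonD)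
  qed
  have "inj_on ?v B" using only_b u by (intro inj_onI) metis
  moreover have "inj_on ?h A" using only_a w by (intro inj_onI) metis
  moreover have "?h ` A \<inter> ?v ` B = {}"
  proof -
    \<comment> \<open>If \<open>?h a = ?v b\<close>, confinement to column \<open>b\<close> forces
      \<open>w a = b = w' a\<close>, against the choice of \<open>w'\<close>.\<close>
    have "?h a \<noteq> ?v b" if "a \<in> A" "b \<in> B" for a b
      using only_b[of b "w a" a] only_b[of b "w' a" a] w[OF that(1)] that by metis
    then show ?thesis by blast
  qed
  ultimately have "card A + card B = card (?h ` A \<union> ?v ` B)"
    using fin by (simp add: card_Un_disjoint card_image)
  also have "\<dots> \<le> card (labels A B f)"
    using u w fin by (intro card_mono finite_labels) (auto simp: labels_def)
  finally show ?thesis .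
qed

section \<open>The lower bound for the cost\<close>

text \<open>With \<open>e = z - x - y\<close>, the difference of \<open>(x + y + e)^2\<close> and
  \<open>4 * (x * y + e)\<close> is \<open>(x - y)^2 + 2 * e * (x + y - 2) + e^2\<close>, a sum of
  nonnegative terms.\<close>

lemma square_ge_of_mult_add_ge:
  fixes x y z K :: int
  assumes "x \<ge> 1" "y \<ge> 1" "z \<ge> x + y" "x * y + (z - x - y) \<ge> K"
  shows "4 * K \<le> z\<^sup>2"
proof -
  define e where "e = z - x - y"
  have "e \<ge> 0" "K \<le> x * y + e" using assms by (auto simp: e_def)
  have "0 \<le> (x - y)\<^sup>2 + 2 * (e * (x + y - 2)) + e\<^sup>2"
    using assms \<open>e \<ge> 0\<close> by (intro add_nonneg_nonneg mult_nonneg_nonneg) auto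
  then have "4 * (x * y + e) \<le> (x + y + e)\<^sup>2"
    by (simp add: power2_eq_square algebra_simps)
  then show ?thesis using \<open>K \<le> x * y + e\<close> by (simp add: e_def)
qed

text \<open>The deficits \<open>g\<close> and \<open>h\<close> make the claim inductive: a deletion
  may leave a row with fewer than \<open>k\<close> labels, or a column with fewer than
  \<open>l\<close>, and the deficit makes up the loss. The first conjunct says that the base of the
  square is nonnegative, so the bound passes from a smaller cost to a larger one.\<close>

lemma cost_lower_bound:
  fixes A :: "'a set" and B :: "'b set" and f :: "'a \<Rightarrow> 'b \<Rightarrow> 'c"
    and g :: "'a \<Rightarrow> nat" and h :: "'b \<Rightarrow> nat" and k l :: nat
  defines "cost \<equiv> \<lambda>A B g h. card (labels A B f) + sum g A + sum h B"
  assumes "finite A" "finite B" "rect_labelling A B f"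
    and "k \<ge> 1" "l \<ge> 1" "card A \<ge> l" "card B \<ge> k"
    and "\<forall>a\<in>A. k \<le> card (f a ` B) + g a"
    and "\<forall>b\<in>B. l \<le> card ((\<lambda>a. f a b) ` A) + h b"
  shows "int k - 1 + (int l - 1) \<le> int (cost A B g h) \<and>
    4 * ((int k - 1) * (int l - 1)) \<le> (int (cost A B g h) - (int k - 1) - (int l - 1))\<^sup>2"
  using assms(2-)
proof (induction "card A + card B" arbitrary: A B g h rule: less_induct)
  case less
  note fin = less.prems(1,2) and rect = less.prems(3) and rows = less.prems(8)
    and cols = less.prems(9)
  have small: ?case if "card A' + card B' < card A + card B" "A' \<subseteq> A" "B' \<subseteq> B"
    "card A' \<ge> l" "card B' \<ge> k" "\<forall>a\<in>A'. k \<le> card (f a ` B') + g' a"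
    "\<forall>b\<in>B'. l \<le> card ((\<lambda>a. f a b) ` A') + h' b" "cost A' B' g' h' \<le> cost A B g h"
    for A' B' g' h'
  proof -
    have ih: "int k - 1 + (int l - 1) \<le> int (cost A' B' g' h') \<and>
      4 * ((int k - 1) * (int l - 1)) \<le> (int (cost A' B' g' h') - (int k - 1) - (int l - 1))\<^sup>2"
      using that less.prems(4,5) finite_subset[OF that(2) fin(1)] finite_subset[OF that(3) fin(2)]
        rect_labelling_subset[OF rect that(2,3)]
      by (intro less.hyps)
    have "(int (cost A' B' g' h') - (int k - 1) - (int l - 1))\<^sup>2
        \<le> (int (cost A B g h) - (int k - 1) - (int l - 1))\<^sup>2"
      using ih that(8) by (intro power_mono) auto
    then show ?thesis using ih that(8) by linarith
  qed
  have "card A * k + card B * l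
      \<le> (\<Sum>a\<in>A. card (f a ` B) + g a) + (\<Sum>b\<in>B. card ((\<lambda>a. f a b) ` A) + h b)"
    using sum_bounded_below[of A k "\<lambda>a. card (f a ` B) + g a"]
      sum_bounded_below[of B l "\<lambda>b. card ((\<lambda>a. f a b) ` A) + h b"] rows cols
    by (simp add: add_mono)
  then have count: "card A * k + card B * l \<le> card A * card B + cost A B g h"
    using card_rect_le[OF fin rect] unfolding cost_def sum.distrib by linarith
  \<comment> \<open>Since \<open>k * l = x * y + x + y + 1\<close>, the base of the square is at
    least \<open>x * y + 1\<close>, and \<open>(x * y + 1)^2\<close> exceeds
    \<open>4 * (x * y)\<close> by \<open>(x * y - 1)^2\<close>.\<close>
  have final: ?case if "cost A B g h \<ge> k * l"
  proof -
    define x y where "x = int k - 1" and "y = int l - 1"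
    have xy: "x \<ge> 0" "y \<ge> 0" using less.prems by (auto simp: x_def y_def)
    have "int (k * l) = x * y + x + y + 1" by (simp add: x_def y_def algebra_simps)
    then have c: "x * y + x + y + 1 \<le> int (cost A B g h)" using that by linarith
    have xy': "0 \<le> x * y" using xy by simp
    have "4 * (x * y) \<le> (x * y + 1)\<^sup>2"
      using zero_le_power2[of "x * y - 1"] by (simp add: power2_eq_square algebra_simps)
    also have "\<dots> \<le> (int (cost A B g h) - x - y)\<^sup>2"
      using c xy' by (intro power_mono) auto
    finally show ?thesis using c xy' unfolding x_def y_def by linarith
  qed
  \<comment> \<open>The strict inequalities let the smaller box still satisfy the size hypotheses
    after a deletion.\<close>
  consider "card A = l" | "card B = k"
    | b where "card B > k" "b \<in> B" "inj_on (\<lambda>a. f a b) {a\<in>A. f a b \<notin> f a ` (B - {b})}"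
    | a where "card A > l" "a \<in> A" "inj_on (f a) {b\<in>B. f a b \<notin> (\<lambda>a. f a b) ` (A - {a})}"
    | "card A > l" "card B > k" "card A + card B \<le> card (labels A B f)"
  proof (cases "card A = l \<or> card B = k")
    case False
    then have "card A > l" "card B > k" using less.prems(6,7) by auto
    then show ?thesis using that(3-5) card_labels_ge[OF fin rect] by blast
  qed (use that in blast)
  then show ?case
  proof cases
    case 1
    \<comment> \<open>For \<open>card A = l\<close> the terms \<open>card B * l\<close> cancel in
      \<open>count\<close>, leaving \<open>l * k\<close> as a bound on the cost.\<close>
    then show ?thesis using count by (intro final) (simp add: mult.commute)
  next
    case 2
    then show ?thesis using count by (intro final) (simp add: mult.commute)
  next
    case (3 b)
    have c: "card (B - {b}) + 1 = card B" using 3 fin card_Suc_Diff1 by fastforce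
    define g' where "g' = (\<lambda>a. g a + (if f a b \<notin> f a ` (B - {b}) then 1 else 0))"
    have d: "cost A (B - {b}) g' h \<le> cost A B g h"
      using delete_column(1)[OF fin rect 3(2,3), where g = g and h = h]
      unfolding cost_def g'_def .
    have r: "\<forall>a\<in>A. k \<le> card (f a ` (B - {b})) + g' a"
      using delete_column(2)[OF fin rect 3(2,3), where g = g] rows order_trans
      unfolding g'_def by blast
    show ?thesis
      using d r cols 3(1) less.prems(6) c by (intro small[of A "B - {b}" g' h]) auto
  next
    case (4 a)
    have c: "card (A - {a}) + 1 = card A" using 4 fin card_Suc_Diff1 by fastforce
    define h' where "h' = (\<lambda>b. h b + (if f a b \<notin> (\<lambda>a. f a b) ` (A - {a}) then 1 else 0))"
    \<comment> \<open>Deleting a row is deleting a column of the transposed labelling, with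
      \<open>g\<close> and \<open>h\<close> exchanged.\<close>
    have d: "cost (A - {a}) B g h' \<le> cost A B g h"
      using delete_column(1)[OF fin(2,1) rect_labelling_swap[OF rect] 4(2,3), where g = h and h = g]
      unfolding cost_def h'_def labels_swap[of B A f] labels_swap[of B "A - {a}" f] by linarith
    have r: "\<forall>b\<in>B. l \<le> card ((\<lambda>a. f a b) ` (A - {a})) + h' b"
      using delete_column(2)[OF fin(2,1) rect_labelling_swap[OF rect] 4(2,3), where g = h]
        cols order_trans
      unfolding h'_def by blast
    show ?thesis
      using d r rows 4(1) less.prems(7) c by (intro small[of "A - {a}" B g h']) auto
  next
    case 5
    \<comment> \<open>In these shifted variables \<open>count\<close> becomes
      \<open>(k - 1) * (l - 1) \<le> x * y + (z - x - y)\<close>, and \<open>z \<ge> x + y\<close>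
      says that the cost is at least \<open>card A + card B\<close>.\<close>
    define x y z where "x = int (card A) - (int l - 1)" and "y = int (card B) - (int k - 1)"
      and "z = int (cost A B g h) - (int k - 1) - (int l - 1)"
    have c: "card A + card B \<le> cost A B g h" using 5 unfolding cost_def by linarith
    have "int (card A) * int k + int (card B) * int l
        \<le> int (card A) * int (card B) + int (cost A B g h)"
      using count by (metis of_nat_le_iff of_nat_add of_nat_mult)
    then have "(int k - 1) * (int l - 1) \<le> x * y + (z - x - y)"
      unfolding x_def y_def z_def by (simp add: algebra_simps)
    moreover have "x \<ge> 1" "y \<ge> 1" "z \<ge> x + y"
      using 5 c unfolding x_def y_def z_def by linarith+
    ultimately have "4 * ((int k - 1) * (int l - 1)) \<le> z\<^sup>2"
      using square_ge_of_mult_add_ge by blast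
    then show ?thesis using c 5 unfolding z_def by linarith
  qed
qed

section \<open>The lower bound for partitions\<close>

lemma piercing_lower_bound:
  assumes "k \<ge> 1" "l \<ge> 1" and sides: "box_sides A B" and part: "partitions_box A B R"
    and pierce: "piercing_property k l A B R"
  shows "int (card R) \<ge> (int k - 1) + (int l - 1) + \<lceil>2 * sqrt ((real k - 1) * (real l - 1))\<rceil>"
proof -
  have fin: "finite A" "finite B" and ne: "A \<noteq> {}" "B \<noteq> {}"
    using sides unfolding box_sides_def by auto
  have sub: "sub_box A B S" if "S \<in> R" for S
    using part that unfolding partitions_box_def by blast
  have "R \<subseteq> Pow (A \<times> B)"
    using sub unfolding sub_box_def by blast
  then have finR: "finite R" using fin by (simp add: finite_subset)
  define f where "f a b = (THE S. S \<in> R \<and> (a, b) \<in> S)" for a b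
  have f: "f a b \<in> R \<and> (a, b) \<in> f a b" if "a \<in> A" "b \<in> B" for a b
    unfolding f_def by (rule theI') (use part that in \<open>auto simp: partitions_box_def\<close>)
  have f_eq: "f a b = S" if "S \<in> R" "(a, b) \<in> S" for a b S
  proof -
    have "(a, b) \<in> A \<times> B" using sub that unfolding sub_box_def by blast
    then have "\<exists>!S. S \<in> R \<and> (a, b) \<in> S" using part unfolding partitions_box_def by blast
    then show ?thesis using that unfolding f_def by (intro the1_equality) auto
  qed
  have rect: "rect_labelling A B f"
    unfolding rect_labelling_def
  proof (intro ballI impI)
    fix a a' b b' assume *: "a \<in> A" "a' \<in> A" "b \<in> B" "b' \<in> B" "f a b = f a' b'"
    then have "(a, b) \<in> f a b" "(a', b') \<in> f a b" "f a b \<in> R" using f by auto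
    then have "(a, b') \<in> f a b" using sub unfolding sub_box_def by fastforce
    then show "f a b' = f a b" using f_eq \<open>f a b \<in> R\<close> by blast
  qed
  have "{S \<in> R. row B a \<inter> S \<noteq> {}} = f a ` B" if "a \<in> A" for a
  proof (intro equalityI subsetI)
    fix S assume "S \<in> {S \<in> R. row B a \<inter> S \<noteq> {}}"
    then obtain b where "b \<in> B" "(a, b) \<in> S" "S \<in> R" unfolding row_def by auto
    then show "S \<in> f a ` B" using f_eq[of S a b] by (intro image_eqI[of _ _ b]) auto
  next
    fix S assume "S \<in> f a ` B"
    then obtain b where "b \<in> B" "S = f a b" by blast
    then show "S \<in> {S \<in> R. row B a \<inter> S \<noteq> {}}" using f[OF that, of b] unfolding row_def by auto
  qed
  then have rows: "\<forall>a\<in>A. k \<le> card (f a ` B)"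
    using pierce unfolding piercing_property_def by simp
  have "{S \<in> R. column A b \<inter> S \<noteq> {}} = (\<lambda>a. f a b) ` A" if "b \<in> B" for b
  proof (intro equalityI subsetI)
    fix S assume "S \<in> {S \<in> R. column A b \<inter> S \<noteq> {}}"
    then obtain a where "a \<in> A" "(a, b) \<in> S" "S \<in> R" unfolding column_def by auto
    then show "S \<in> (\<lambda>a. f a b) ` A" using f_eq[of S a b] by (intro image_eqI[of _ _ a]) auto
  next
    fix S assume "S \<in> (\<lambda>a. f a b) ` A"
    then obtain a where "a \<in> A" "S = f a b" by blast
    then show "S \<in> {S \<in> R. column A b \<inter> S \<noteq> {}}"
      using f[of a b] that unfolding column_def by auto
  qed
  then have cols: "\<forall>b\<in>B. l \<le> card ((\<lambda>a. f a b) ` A)"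
    using pierce unfolding piercing_property_def by simp
  from ne obtain a0 b0 where "a0 \<in> A" "b0 \<in> B" by blast
  then have "k \<le> card B" "l \<le> card A"
    using rows cols card_image_le[OF fin(2), of "f a0"] card_image_le[OF fin(1), of "\<lambda>a. f a b0"]
    by fastforce+
  \<comment> \<open>The deficits start at zero, so the initial cost is the number of labels.\<close>
  then have b: "int k - 1 + (int l - 1) \<le> int (card (labels A B f))"
    "4 * ((int k - 1) * (int l - 1)) \<le> (int (card (labels A B f)) - (int k - 1) - (int l - 1))\<^sup>2"
    using cost_lower_bound[of A B f k l "\<lambda>_. 0" "\<lambda>_. 0"] fin rect rows cols assms(1,2) by auto
  define z where "z = int (card (labels A B f)) - (int k - 1) - (int l - 1)"
  have "real_of_int (4 * ((int k - 1) * (int l - 1))) \<le> real_of_int (z\<^sup>2)"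
    using b(2) unfolding z_def of_int_le_iff .
  then have "2\<^sup>2 * ((real k - 1) * (real l - 1)) \<le> (real_of_int z)\<^sup>2" by simp
  then have "sqrt (2\<^sup>2 * ((real k - 1) * (real l - 1))) \<le> real_of_int z"
    using b(1) by (intro real_le_lsqrt) (auto simp: z_def)
  then have "\<lceil>2 * sqrt ((real k - 1) * (real l - 1))\<rceil> \<le> z"
    by (simp add: real_sqrt_mult ceiling_le_iff)
  \<comment> \<open>Equality may fail: \<open>R\<close> may contain the empty sub-box, which labels
    no cell.\<close>
  moreover have "card (labels A B f) \<le> card R"
    using f finR by (intro card_mono) (auto simp: labels_def)
  ultimately show ?thesis unfolding z_def by linarith
qed

section \<open>The construction from zero-one matrices\<close>

text \<open>Row \<open>i\<close> meets its own box \<open>H i\<close> of zeros and one box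
  \<open>V j\<close> for each of its ones; columns are dual. Every row has a zero and every column a
  one, so all these boxes are nonempty and hence distinct, which gives the exact count.\<close>

lemma partition_of_matrix:
  fixes A :: "'a set" and B :: "'b set" and one :: "'a \<Rightarrow> 'b \<Rightarrow> bool"
  assumes fin: "finite A" "finite B"
    and ones: "\<And>i. i \<in> A \<Longrightarrow> K \<le> card {j\<in>B. one i j}"
    and zeros: "\<And>j. j \<in> B \<Longrightarrow> L \<le> card {i\<in>A. \<not> one i j}"
    and zero: "\<And>i. i \<in> A \<Longrightarrow> \<exists>j\<in>B. \<not> one i j"
    and one: "\<And>j. j \<in> B \<Longrightarrow> \<exists>i\<in>A. one i j"
  shows "\<exists>R. partitions_box A B R \<and> piercing_property (K + 1) (L + 1) A B R
           \<and> card R = card A + card B"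
proof -
  define V where "V j = {i\<in>A. one i j} \<times> {j}" for j
  define H where "H i = {i} \<times> {j\<in>B. \<not> one i j}" for i
  define R where "R = H ` A \<union> V ` B"
  have injV: "inj_on V B" unfolding V_def by (intro inj_onI) (use one in blast)
  have injH: "inj_on H A" unfolding H_def by (intro inj_onI) (use zero in blast)
  have HV: "H i \<noteq> V j" if "i \<in> A" for i j
    using zero[OF that] unfolding H_def V_def by blast
  have "card R = card A + card B"
    unfolding R_def using fin injV injH HV by (subst card_Un_disjoint) (auto simp: card_image)
  moreover have "partitions_box A B R"
    unfolding partitions_box_def
  proof (intro conjI ballI)
    have "sub_box A B (H i)" if "i \<in> A" for i
      unfolding sub_box_def H_def using that
      by (intro exI[of _ "{i}"] exI[of _ "{j\<in>B. \<not> one i j}"]) auto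
    moreover have "sub_box A B (V j)" if "j \<in> B" for j
      unfolding sub_box_def V_def using that
      by (intro exI[of _ "{i\<in>A. one i j}"] exI[of _ "{j}"]) auto
    ultimately show "sub_box A B S" if "S \<in> R" for S
      using that unfolding R_def by blast
  next
    fix x assume "x \<in> A \<times> B"
    then obtain i j where x: "x = (i, j)" "i \<in> A" "j \<in> B" by blast
    show "\<exists>!S. S \<in> R \<and> x \<in> S"
    proof (cases "one i j")
      case True
      then show ?thesis using x unfolding R_def
        by (intro ex1I[of _ "V j"]) (auto simp: H_def V_def)
    next
      case False
      then show ?thesis using x unfolding R_def
        by (intro ex1I[of _ "H i"]) (auto simp: H_def V_def)
    qed
  qed
  moreover have "piercing_property (K + 1) (L + 1) A B R"
    unfolding piercing_property_def
  proof (intro conjI ballI)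
    fix i assume i: "i \<in> A"
    let ?J = "{j\<in>B. one i j}"
    have "K + 1 \<le> card ?J + 1" using ones[OF i] by simp
    also have "\<dots> = card (insert (H i) (V ` ?J))"
      using HV[OF i] fin inj_on_subset[OF injV, of ?J]
      by (subst card_insert_disjoint) (auto simp: card_image)
    also have "\<dots> \<le> card {S \<in> R. row B i \<inter> S \<noteq> {}}"
      using fin i zero[OF i] by (intro card_mono) (auto simp: R_def row_def H_def V_def)
    finally show "K + 1 \<le> card {S \<in> R. row B i \<inter> S \<noteq> {}}" .
  next
    fix j assume j: "j \<in> B"
    let ?I = "{i\<in>A. \<not> one i j}"
    have "V j \<notin> H ` ?I" using HV[of _ j] by fastforce
    have "L + 1 \<le> card ?I + 1" using zeros[OF j] by simp
    also have "\<dots> = card (insert (V j) (H ` ?I))"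
      using \<open>V j \<notin> H ` ?I\<close> fin inj_on_subset[OF injH, of ?I]
      by (subst card_insert_disjoint) (auto simp: card_image)
    also have "\<dots> \<le> card {S \<in> R. column A j \<inter> S \<noteq> {}}"
      using fin j one[OF j] by (intro card_mono) (auto simp: R_def column_def H_def V_def)
    finally show "L + 1 \<le> card {S \<in> R. column A j \<inter> S \<noteq> {}}" .
  qed
  ultimately show ?thesis by blast
qed

text \<open>Such a \<open>p\<close> is determined by its quotient \<open>p div N\<close>, which is
  below \<open>c\<close>. This will bound the number of ones in a column.\<close>

lemma card_mod_eq_le:
  fixes c N j :: nat
  assumes "N > 0"
  shows "card {p. p < c * N \<and> p mod N = j} \<le> c"
proof -
  have "{p. p < c * N \<and> p mod N = j} \<subseteq> (\<lambda>q. q * N + j) ` {..<c}"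
  proof
    fix p assume p: "p \<in> {p. p < c * N \<and> p mod N = j}"
    then have "p = (p div N) * N + j" by (metis (mono_tags) div_mult_mod_eq mem_Collect_eq)
    moreover have "p div N < c" using p by (simp add: less_mult_imp_div_less)
    ultimately show "p \<in> (\<lambda>q. q * N + j) ` {..<c}" by blast
  qed
  then have "card {p. p < c * N \<and> p mod N = j} \<le> card ((\<lambda>q. q * N + j) ` {..<c})"
    by (intro card_mono) auto
  also have "\<dots> \<le> c" using card_image_le[of "{..<c}"] by fastforce
  finally show ?thesis .
qed

text \<open>Row \<open>i\<close> of the matrix carries its \<open>K\<close> ones at the cyclically consecutive positions
  \<open>i * K, \<dots>, i * K + K - 1\<close> modulo the number of columns, which spreads them
  evenly over the columns.\<close>

lemma piercing_partition_exists:
  fixes K L c :: nat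
  assumes pos: "K \<ge> 1" "L \<ge> 1" "c \<ge> 1" and c: "K * L \<le> c * c"
  shows "\<exists>R. partitions_box {..<L + c} {..<K + c} R
           \<and> piercing_property (K + 1) (L + 1) {..<L + c} {..<K + c} R
           \<and> card R = (L + c) + (K + c)"
proof -
  define M N where "M = L + c" and "N = K + c"
  have N0: "N > 0" and KN: "K < N" using pos by (auto simp: N_def)
  define one where "one i j \<longleftrightarrow> (\<exists>r<K. (i * K + r) mod N = j)" for i j
  have row_eq: "{j\<in>{..<N}. one i j} = (\<lambda>r. (i * K + r) mod N) ` {..<K}" for i
    unfolding one_def using N0 by auto
  \<comment> \<open>Fewer than \<open>N\<close> consecutive numbers have distinct residues modulo
    \<open>N\<close>.\<close>
  have inj: "inj_on (\<lambda>r. (i * K + r) mod N) {..<K}" for i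
  proof (rule inj_onI)
    fix r s assume *: "r \<in> {..<K}" "s \<in> {..<K}" "(i * K + r) mod N = (i * K + s) mod N"
    have eq: "r = s" if "r \<le> s" "s < K" "(i * K + r) mod N = (i * K + s) mod N" for r s
    proof -
      have "N dvd (i * K + s) - (i * K + r)"
        using that mod_eq_dvd_iff_nat[of "i * K + r" "i * K + s" N] by simp
      then have "N dvd s - r" by simp
      then show ?thesis using that KN by (auto dest: dvd_imp_le)
    qed
    show "r = s"
    proof (cases "r \<le> s")
      case True
      then show ?thesis using eq[of r s] * by blast
    next
      case False
      then show ?thesis using eq[of s r] * by (simp only: lessThan_iff not_le less_imp_le)
    qed
  qed
  have card_row: "card {j\<in>{..<N}. one i j} = K" for i
    unfolding row_eq using card_image[OF inj] by simp
  \<comment> \<open>After cancelling \<open>c * K\<close> this is \<open>K * L \<le> c * c\<close>: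
    the \<open>M * K\<close> positions wrap around the \<open>N\<close> columns at most
    \<open>c\<close> times.\<close>
  have MK: "M * K \<le> c * N"
    using c by (simp add: M_def N_def algebra_simps)
  have "\<exists>R. partitions_box {..<M} {..<N} R \<and> piercing_property (K + 1) (L + 1) {..<M} {..<N} R
           \<and> card R = card {..<M} + card {..<N}"
  proof (rule partition_of_matrix[where one = one])
    show "K \<le> card {j\<in>{..<N}. one i j}" for i using card_row by simp
    show "\<exists>j\<in>{..<N}. \<not> one i j" for i
    proof (rule ccontr)
      assume "\<not> ?thesis"
      then have "{j\<in>{..<N}. one i j} = {..<N}" by blast
      then show False using card_row[of i] KN by simp
    qed
    fix j assume "j \<in> {..<N}"
    then have j: "j < N" by simp
    \<comment> \<open>The positions make at least one full turn, so column \<open>j\<close> receives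
      a one from position \<open>j\<close> itself, which lies in row \<open>j div K\<close>.\<close>
    have "1 * K \<le> L * K" "c * 1 \<le> c * K" using pos by (auto intro: mult_le_mono)
    then have "N \<le> M * K" unfolding M_def N_def add_mult_distrib by linarith
    then have "j div K < M" using j by (simp add: less_mult_imp_div_less)
    moreover have "one (j div K) j"
      unfolding one_def using j pos by (intro exI[of _ "j mod K"]) simp
    ultimately show "\<exists>i\<in>{..<M}. one i j" by blast
    \<comment> \<open>A one in row \<open>i\<close> of column \<open>j\<close> comes from a position
      \<open>p = i * K + r\<close> with residue \<open>j\<close>, and \<open>p div K\<close>
      recovers \<open>i\<close>.\<close>
    have "{i\<in>{..<M}. one i j} \<subseteq> (\<lambda>p. p div K) ` {p. p < c * N \<and> p mod N = j}"
    proof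
      fix i assume "i \<in> {i\<in>{..<M}. one i j}"
      then obtain r where r: "i < M" "r < K" "(i * K + r) mod N = j" unfolding one_def by blast
      have "i * K + r < Suc i * K" using r by simp
      also have "\<dots> \<le> M * K" using r by (intro mult_le_mono1) simp
      finally have "i * K + r < c * N" using MK by linarith
      moreover have "(i * K + r) div K = i" using r by simp
      ultimately show "i \<in> (\<lambda>p. p div K) ` {p. p < c * N \<and> p mod N = j}"
        using r by (intro image_eqI[of _ _ "i * K + r"]) auto
    qed
    then have "card {i\<in>{..<M}. one i j} \<le> card {p. p < c * N \<and> p mod N = j}"
      by (intro surj_card_le) auto
    also have "\<dots> \<le> c" by (rule card_mod_eq_le[OF N0])
    finally have "card {i\<in>{..<M}. one i j} \<le> c" .
    moreover have "card {i\<in>{..<M}. one i j} + card {i\<in>{..<M}. \<not> one i j} = M"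
    proof -
      have "{i\<in>{..<M}. one i j} \<union> {i\<in>{..<M}. \<not> one i j} = {..<M}" by blast
      then show ?thesis by (subst card_Un_disjoint[symmetric]) auto
    qed
    ultimately show "L \<le> card {i\<in>{..<M}. \<not> one i j}" unfolding M_def by linarith
  qed auto
  then show ?thesis by (simp add: M_def N_def)
qed

theorem theorem1:
  fixes k l :: nat
  assumes "k \<ge> 2" and "l \<ge> 2"
  shows "(\<forall>(A :: 'a set) (B :: 'b set) R.
            box_sides A B \<and> partitions_box A B R \<and> piercing_property k l A B R \<longrightarrow>
            int (card R) \<ge> (int k - 1) + (int l - 1)
              + \<lceil>2 * sqrt ((real k - 1) * (real l - 1))\<rceil>)
       \<and> (\<exists>(A :: nat set) (B :: nat set) R.
            box_sides A B \<and> partitions_box A B R \<and> piercing_property k l A B R \<and>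
            int (card R) = (int k - 1) + (int l - 1)
              + 2 * \<lceil>sqrt ((real k - 1) * (real l - 1))\<rceil>)"
proof (intro conjI allI impI)
  fix A :: "'a set" and B :: "'b set" and R
  assume "box_sides A B \<and> partitions_box A B R \<and> piercing_property k l A B R"
  then show "int (card R) \<ge> (int k - 1) + (int l - 1)
              + \<lceil>2 * sqrt ((real k - 1) * (real l - 1))\<rceil>"
    using assms by (intro piercing_lower_bound) auto
next
  define K L where "K = k - 1" and "L = l - 1"
  have KL: "K \<ge> 1" "L \<ge> 1" "k = K + 1" "l = L + 1" using assms by (auto simp: K_def L_def)
  define s where "s = sqrt (real K * real L)"
  define c where "c = nat \<lceil>s\<rceil>"
  have "s > 0" using KL by (simp add: s_def)
  then have c: "int c = \<lceil>s\<rceil>" "c \<ge> 1" by (simp_all add: c_def Suc_le_eq)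
  have "s \<le> real c" using c(1) by (metis le_of_int_ceiling of_int_of_nat_eq)
  then have "s\<^sup>2 \<le> (real c)\<^sup>2" using \<open>s > 0\<close> by (intro power_mono) auto
  then have "real (K * L) \<le> real (c * c)" by (simp add: s_def power2_eq_square)
  then have "K * L \<le> c * c" by (simp only: of_nat_le_iff)
  then obtain R where R: "partitions_box {..<L + c} {..<K + c} R"
    "piercing_property k l {..<L + c} {..<K + c} R" "card R = (L + c) + (K + c)"
    using piercing_partition_exists[OF KL(1,2) c(2)] KL(3,4) by blast
  have "box_sides {..<L + c} {..<K + c}" using KL c by (simp add: box_sides_def)
  moreover have "int (card R) = (int k - 1) + (int l - 1)
              + 2 * \<lceil>sqrt ((real k - 1) * (real l - 1))\<rceil>"
    using R(3) c(1) KL(3,4) by (simp add: s_def)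
  ultimately show "\<exists>(A :: nat set) (B :: nat set) R.
            box_sides A B \<and> partitions_box A B R \<and> piercing_property k l A B R \<and>
            int (card R) = (int k - 1) + (int l - 1)
              + 2 * \<lceil>sqrt ((real k - 1) * (real l - 1))\<rceil>"
    using R by blast
qed

end
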